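(* Let $n$ be a positive integer and $p$ a prime number. If $n = p^k$, where $k$ is a positive integer, or if $n = 2^k p^\ell$, where $k, \ell$ are positive integers and $p$ is odd, then $$\operatorname{Cond}(V_n) = \varphi(n)\sqrt{2\left(1 - \frac{1}{p}\right)},$$ where $V_n$ is the Vandermonde matrix associated with the $n$th cyclotomic polynomial and $\varphi$ is Euler's totient function.
   Context: For a positive integer $n$, let $m := \varphi(n)$ (Euler's totient function) and let $\zeta_1, \dots, \zeta_m \in \mathbb{C}$ be the primitive $n$th roots of unity (listed in any fixed order). The Vandermonde matrix associated with the $n$th cyclotomic polynomial is the $m \times m$ complex matrix $V_n := (\zeta_i^{\,j-1})_{1 \leq i,j \leq m}$; it is invertible since the $\zeta_i$ are distinct. The condition number of an invertible complex $k \times k$ matrix $A = (a_{i,j})$ is $\operatorname{Cond}(A) := \|A\|\,\|A^{-1}\|$, where $\|A\| := \sqrt{\sum_{i=1}^k \sum_{j=1}^k |a_{i,j}|^2} = \sqrt{\operatorname{Tr}(A^*A)}$ is the Frobenius norm and $A^*$ is the conjugate transpose of $A$. *)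

theory Defs
  imports
    Complex_Main
    "HOL-Number_Theory.Totient"
    "Jordan_Normal_Form.Gauss_Jordan_Elimination"
    "Jordan_Normal_Form.Determinant"
begin

definition primitive_roots_of_unity :: "nat \<Rightarrow> complex set" where
  "primitive_roots_of_unity n = {z. z ^ n = 1 \<and> (\<forall>k. 0 < k \<and> k < n \<longrightarrow> z ^ k \<noteq> 1)}"

(* Indices are 0-based, so the (i,j) entry is the j-th (not (j-1)-th) power. *)
definition vandermonde_mat :: "nat \<Rightarrow> (nat \<Rightarrow> complex) \<Rightarrow> complex mat" where
  "vandermonde_mat m \<zeta> = mat m m (\<lambda>(i, j). \<zeta> i ^ j)"

definition frobenius_norm :: "complex mat \<Rightarrow> real" where
  "frobenius_norm A = sqrt (\<Sum>i<dim_row A. \<Sum>j<dim_col A. (cmod (A $$ (i, j)))\<^sup>2)"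

(* Meaningful only for invertible A: otherwise mat_inverse A = None. *)
definition mat_cond :: "complex mat \<Rightarrow> real" where
  "mat_cond A = frobenius_norm A * frobenius_norm (the (mat_inverse A))"

lemma mat_inverse_eqI:
  fixes A B :: "'a :: field mat"
  assumes A: "A \<in> carrier_mat n n" and B: "B \<in> carrier_mat n n" and AB: "A * B = 1\<^sub>m n"
  shows "mat_inverse A = Some B"
proof -
  have BA: "B * A = 1\<^sub>m n"
    by (rule mat_mult_left_right_inverse[OF A B AB])
  have "A \<in> Units (ring_mat TYPE('a) n ())"
    unfolding Units_def ring_mat_def using A B AB BA by auto
  then obtain C where C: "mat_inverse A = Some C"
    using mat_inverse(1)[OF A, where b = "()"] by (cases "mat_inverse A") auto
  from mat_inverse(2)[OF A C] have CA: "C * A = 1\<^sub>m n" and Cc: "C \<in> carrier_mat n n"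
    by auto
  have "C = C * (A * B)" using AB Cc by simp
  also have "\<dots> = (C * A) * B" using A B Cc by simp
  also have "\<dots> = B" using CA B by simp
  finally show ?thesis using C by simp
qed

lemma mat_cond_eqI:
  assumes "A \<in> carrier_mat n n" "B \<in> carrier_mat n n" "A * B = 1\<^sub>m n"
  shows "mat_cond A = frobenius_norm A * frobenius_norm B"
  using mat_inverse_eqI[OF assms] by (simp add: mat_cond_def)

end

theory Submission
  imports Defs
begin

text \<open>
  In both cases there are \<open>q\<close> and a sign \<open>\<epsilon>\<close> with \<open>\<phi>(n) = (p - 1) q\<close> such that \<open>\<eta> = \<epsilon> \<zeta>\<^sup>q\<close> is
  a nontrivial \<open>p\<close>-th root of unity for each primitive \<open>n\<close>-th root of unity \<open>\<zeta>\<close>: take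
  \<open>q = n / p\<close>, \<open>\<epsilon> = 1\<close> if \<open>n\<close> is a power of \<open>p\<close>, and \<open>q = n / (2 p)\<close>, \<open>\<epsilon> = -1\<close> otherwise.
  Write a column index as \<open>j = a q + b\<close> with \<open>b < q\<close>, so that \<open>\<zeta>\<^sup>j = \<epsilon>\<^sup>a \<zeta>\<^sup>b \<eta>\<^sup>a\<close>. The inverse of the
  Vandermonde matrix has as \<open>(j, l)\<close> entry the conjugate of
  \<open>\<epsilon>\<^sup>a \<zeta>\<^sub>l\<^sup>b (\<eta>\<^sub>l\<^sup>a - \<eta>\<^sub>l\<^sup>p\<^sup>-\<^sup>1) / (p q)\<close>: since the powers of \<open>\<eta>\<close> sum to \<open>0\<close>, the subtracted term
  supplies the missing summands \<open>a = p - 1\<close> of a full geometric sum of length \<open>p q\<close> in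
  \<open>\<zeta>\<^sub>i / \<zeta>\<^sub>l\<close>. The squared Frobenius norms are then sums of \<open>\<bar>\<eta>\<^sup>a - \<eta>\<^sup>p\<^sup>-\<^sup>1\<bar>\<^sup>2\<close> over \<open>a\<close>, each equal
  to \<open>2 p\<close>.
\<close>

text \<open>Applied with \<open>r = p - 1\<close> to split the column index into block and offset,
  and with \<open>r = p\<close> to reassemble a full geometric sum.\<close>

lemma sum_div_mod:
  fixes f :: "nat \<Rightarrow> nat \<Rightarrow> 'a :: comm_monoid_add"
  assumes "q > 0"
  shows "(\<Sum>j<r * q. f (j div q) (j mod q)) = (\<Sum>a<r. \<Sum>b<q. f a b)"
proof -
  have "(\<Sum>j<r * q. f (j div q) (j mod q))
      = (\<Sum>a<r. \<Sum>j = a * q..<a * q + q. f (j div q) (j mod q))"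
    by (rule sum.nat_group [symmetric])
  also have "\<dots> = (\<Sum>a<r. \<Sum>b<q. f a b)"
  proof (rule sum.cong [OF refl])
    fix a
    have "(\<Sum>j = a * q..<a * q + q. f (j div q) (j mod q))
        = (\<Sum>b = 0..<q. f ((b + a * q) div q) ((b + a * q) mod q))"
      using sum.shift_bounds_nat_ivl[of "\<lambda>j. f (j div q) (j mod q)" 0 "a * q" q]
      by (simp add: add.commute)
    also have "\<dots> = (\<Sum>b<q. f a b)"
      using assms by (intro sum.cong) auto
    finally show "(\<Sum>j = a * q..<a * q + q. f (j div q) (j mod q)) = (\<Sum>b<q. f a b)" .
  qed
  finally show ?thesis .
qed

lemma sum_powers_root_of_unity:
  fixes w :: "'a :: field"
  assumes "w ^ N = 1" "w \<noteq> 1"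
  shows "(\<Sum>a<N. w ^ a) = 0"
  using assms by (simp add: geometric_sum)

text \<open>The term \<open>a = p - 1\<close> vanishes, so the sum may run over all
  \<open>a < p\<close>; there the cross terms cancel because the powers of \<open>w\<close> sum to
  \<open>0\<close>.\<close>

lemma sum_cmod_diff_powers:
  fixes w :: complex
  assumes "w ^ p = 1" "w \<noteq> 1" "p > 0"
  shows "(\<Sum>a<p - 1. (cmod (w ^ a - w ^ (p - 1)))\<^sup>2) = 2 * real p"
proof -
  have w: "cmod (w ^ a) = 1" for a
    using power_eq_1_iff[OF assms(1)] assms(3) by (simp add: norm_power)
  define c where "c = w ^ (p - 1)"
  have "(cmod (w ^ a - c))\<^sup>2 = 2 - 2 * Re (w ^ a * cnj c)" for a
    using arg_cong[OF w[of a], of power2] arg_cong[OF w[of "p - 1"], of power2]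
    unfolding c_def[symmetric] cmod_power2 by (simp add: power2_eq_square algebra_simps)
  then have "(\<Sum>a<p. (cmod (w ^ a - c))\<^sup>2) = 2 * real p - 2 * Re ((\<Sum>a<p. w ^ a) * cnj c)"
    by (simp add: sum_subtractf sum_distrib_left sum_distrib_right)
  also have "\<dots> = 2 * real p"
    using sum_powers_root_of_unity[OF assms(1,2)] by simp
  also have "(\<Sum>a<p. (cmod (w ^ a - c))\<^sup>2) = (\<Sum>a<p - 1. (cmod (w ^ a - c))\<^sup>2)"
    using assms(3) by (cases p) (auto simp: c_def)
  finally show ?thesis by (simp add: c_def)
qed

lemma frobenius_norm_vandermonde_mat:
  assumes "\<And>i. i < m \<Longrightarrow> cmod (\<zeta> i) = 1"
  shows "frobenius_norm (vandermonde_mat m \<zeta>) = real m"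
proof -
  have "(\<Sum>i<m. \<Sum>j<m. (cmod (vandermonde_mat m \<zeta> $$ (i, j)))\<^sup>2) = (\<Sum>i<m. \<Sum>j<m. 1)"
    by (intro sum.cong) (auto simp: vandermonde_mat_def assms norm_power)
  then show ?thesis
    by (simp add: frobenius_norm_def vandermonde_mat_def)
qed

text \<open>The Vandermonde entries are unimodular, which gives norm \<open>m\<close>; each column
  of the inverse has squared norm \<open>2 / (p * q)\<close>, and \<open>m\<close> of them add up to
  \<open>2 * (1 - 1 / p)\<close>.\<close>

lemma mat_cond_vandermonde_mat:
  fixes \<zeta> :: "nat \<Rightarrow> complex" and \<epsilon> :: complex
  assumes p: "p > 1" and q: "q > 0" and m: "m = (p - 1) * q"
    and \<epsilon>: "\<epsilon> = 1 \<or> \<epsilon> = -1"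
    and inj: "inj_on \<zeta> {..<m}"
    and root: "\<And>i. i < m \<Longrightarrow> (\<epsilon> * \<zeta> i ^ q) ^ p = 1"
    and nontriv: "\<And>i. i < m \<Longrightarrow> \<epsilon> * \<zeta> i ^ q \<noteq> 1"
  shows "mat_cond (vandermonde_mat m \<zeta>) = real m * sqrt (2 * (1 - 1 / real p))"
proof -
  define \<eta> where "\<eta> = (\<lambda>i. \<epsilon> * \<zeta> i ^ q)"
  define C where "C = (\<lambda>l a b. \<epsilon> ^ a * \<zeta> l ^ b * (\<eta> l ^ a - \<eta> l ^ (p - 1)))"
  define B where "B = mat m m (\<lambda>(j, l). cnj (C l (j div q) (j mod q)) / of_nat (p * q))"
  have \<epsilon>\<epsilon>: "\<epsilon> ^ a * \<epsilon> ^ a = 1" "\<epsilon> * \<epsilon> = 1" "cnj \<epsilon> = \<epsilon>" "cmod \<epsilon> = 1" for a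
    using \<epsilon> by (auto simp flip: power_mult_distrib)
  have norm_\<eta>: "cmod (\<eta> i) = 1" if "i < m" for i
    using power_eq_1_iff[OF root[OF that]] p by (simp add: \<eta>_def)
  have norm_\<zeta>: "cmod (\<zeta> i) = 1" if "i < m" for i
  proof -
    have "cmod (\<zeta> i) ^ q = 1"
      using norm_\<eta>[OF that] by (simp add: \<eta>_def norm_mult norm_power \<epsilon>\<epsilon>)
    then show ?thesis using q power_eq_imp_eq_base[of "cmod (\<zeta> i)" q 1] by simp
  qed
  have entry: "\<zeta> i ^ j = \<epsilon> ^ (j div q) * \<zeta> i ^ (j mod q) * \<eta> i ^ (j div q)" for i j
  proof -
    have "\<zeta> i ^ j = \<zeta> i ^ (q * (j div q) + j mod q)" by simp
    also have "\<dots> = \<zeta> i ^ (j mod q) * (\<zeta> i ^ q) ^ (j div q)"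
      by (simp only: power_add power_mult mult.commute)
    also have "\<zeta> i ^ q = \<epsilon> * \<eta> i"
      by (simp add: \<eta>_def mult.assoc[symmetric] \<epsilon>\<epsilon>)
    finally show ?thesis by (simp add: power_mult_distrib)
  qed
  have AB: "vandermonde_mat m \<zeta> * B = 1\<^sub>m m"
  proof (rule eq_matI)
    fix i l assume "i < dim_row (1\<^sub>m m :: complex mat)" "l < dim_col (1\<^sub>m m :: complex mat)"
    then have il: "i < m" "l < m" by auto
    define w where "w = \<zeta> i * cnj (\<zeta> l)"
    have w_\<eta>: "\<eta> i * cnj (\<eta> l) = w ^ q"
      using \<epsilon>\<epsilon> by (simp add: \<eta>_def w_def power_mult_distrib algebra_simps)
    have geom: "(\<Sum>a<p. \<eta> i ^ a) = 0"
      using sum_powers_root_of_unity[of "\<eta> i" p] root nontriv il by (simp add: \<eta>_def)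
    have "(vandermonde_mat m \<zeta> * B) $$ (i, l)
        = (\<Sum>j<m. \<zeta> i ^ j * (cnj (C l (j div q) (j mod q)) / of_nat (p * q)))"
      using il by (simp add: vandermonde_mat_def B_def scalar_prod_def lessThan_atLeast0)
    also have "\<dots> = (\<Sum>j<m. \<epsilon> ^ (j div q) * \<zeta> i ^ (j mod q) * \<eta> i ^ (j div q)
                      * (cnj (C l (j div q) (j mod q)) / of_nat (p * q)))"
      by (subst entry) simp
    also have "\<dots> = (\<Sum>a<p - 1. \<Sum>b<q. \<epsilon> ^ a * \<zeta> i ^ b * \<eta> i ^ a * (cnj (C l a b) / of_nat (p * q)))"
      unfolding m by (rule sum_div_mod[OF q])
    \<comment> \<open>The added term \<open>a = p - 1\<close> is zero, because
      \<open>C l (p - 1) b = 0\<close>.\<close>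
    also have "\<dots> = (\<Sum>a<p. \<Sum>b<q. \<epsilon> ^ a * \<zeta> i ^ b * \<eta> i ^ a * (cnj (C l a b) / of_nat (p * q)))"
      using p by (cases p) (auto simp: C_def)
    \<comment> \<open>The signs cancel in pairs. The subtracted part contains \<open>a\<close> only
      through \<open>\<eta> i ^ a\<close>, so \<open>geom\<close> will remove it.\<close>
    also have "\<dots> = (\<Sum>a<p. \<Sum>b<q. w ^ b * (w ^ q) ^ a / of_nat (p * q)
                       - w ^ b * cnj (\<eta> l ^ (p - 1)) / of_nat (p * q) * \<eta> i ^ a)"
    proof (intro sum.cong refl)
      fix a b
      have "\<epsilon> ^ a * \<zeta> i ^ b * \<eta> i ^ a * cnj (C l a b)
          = (\<epsilon> ^ a * \<epsilon> ^ a) * (\<zeta> i * cnj (\<zeta> l)) ^ b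
              * ((\<eta> i * cnj (\<eta> l)) ^ a - \<eta> i ^ a * cnj (\<eta> l ^ (p - 1)))"
        by (simp add: C_def \<epsilon>\<epsilon>(3) power_mult_distrib algebra_simps)
      also have "\<dots> = w ^ b * (w ^ q) ^ a - w ^ b * cnj (\<eta> l ^ (p - 1)) * \<eta> i ^ a"
        unfolding w_\<eta> \<epsilon>\<epsilon>(1) w_def[symmetric] by (simp add: algebra_simps)
      finally show "\<epsilon> ^ a * \<zeta> i ^ b * \<eta> i ^ a * (cnj (C l a b) / of_nat (p * q))
          = w ^ b * (w ^ q) ^ a / of_nat (p * q)
              - w ^ b * cnj (\<eta> l ^ (p - 1)) / of_nat (p * q) * \<eta> i ^ a"
        by (simp add: diff_divide_distrib)
    qed
    also have "\<dots> = (\<Sum>a<p. \<Sum>b<q. w ^ b * (w ^ q) ^ a / of_nat (p * q))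
        - (\<Sum>b<q. \<Sum>a<p. w ^ b * cnj (\<eta> l ^ (p - 1)) / of_nat (p * q) * \<eta> i ^ a)"
      by (subst (3) sum.swap) (simp only: sum_subtractf)
    also have "\<dots> = (\<Sum>a<p. \<Sum>b<q. w ^ b * (w ^ q) ^ a / of_nat (p * q))"
      by (simp only: sum_distrib_left[symmetric] geom) simp
    \<comment> \<open>The exponents \<open>b + a * q\<close> run through every
      \<open>t < p * q\<close> exactly once.\<close>
    also have "\<dots> = (\<Sum>t<p * q. w ^ (t mod q) * (w ^ q) ^ (t div q) / of_nat (p * q))"
      by (rule sum_div_mod[OF q, symmetric])
    also have "\<dots> = (\<Sum>t<p * q. w ^ t) / of_nat (p * q)"
      unfolding sum_divide_distrib power_mult[symmetric] power_add[symmetric] by simp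
    also have "\<dots> = 1\<^sub>m m $$ (i, l)"
    proof (cases "i = l")
      case True
      then have "w = 1"
        using norm_\<zeta>[OF il(2)] by (simp add: w_def complex_norm_square[symmetric])
      then show ?thesis using True il p q by simp
    next
      case False
      have "w \<noteq> 1"
      proof
        assume "w = 1"
        then have "\<zeta> i * (cnj (\<zeta> l) * \<zeta> l) = \<zeta> l"
          by (simp add: w_def mult.assoc[symmetric])
        then have "\<zeta> i = \<zeta> l"
          using norm_\<zeta>[OF il(2)] by (simp add: complex_norm_square[symmetric] mult.commute)
        then show False using inj il False by (auto dest: inj_onD)
      qed
      moreover have "w ^ (p * q) = 1"
      proof -
        have "w ^ (p * q) = (\<eta> i * cnj (\<eta> l)) ^ p"
          unfolding w_\<eta> by (simp add: power_mult[symmetric] mult.commute)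
        also have "\<dots> = \<eta> i ^ p * cnj (\<eta> l ^ p)"
          by (simp add: power_mult_distrib)
        finally show ?thesis using root il by (simp add: \<eta>_def)
      qed
      ultimately show ?thesis
        using False il by (simp add: sum_powers_root_of_unity)
    qed
    finally show "(vandermonde_mat m \<zeta> * B) $$ (i, l) = 1\<^sub>m m $$ (i, l)" .
  qed (auto simp: vandermonde_mat_def B_def)
  have norm_B: "(\<Sum>j<m. \<Sum>l<m. (cmod (B $$ (j, l)))\<^sup>2) = 2 * (1 - 1 / real p)"
  proof -
    have "(\<Sum>j<m. \<Sum>l<m. (cmod (B $$ (j, l)))\<^sup>2) = (\<Sum>l<m. \<Sum>j<m. (cmod (B $$ (j, l)))\<^sup>2)"
      by (rule sum.swap)
    also have "\<dots> = (\<Sum>l<m. 2 / real (p * q))"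
    proof (rule sum.cong[OF refl])
      fix l assume "l \<in> {..<m}"
      then have l: "l < m" by simp
      \<comment> \<open>The factors \<open>\<epsilon> ^ a\<close> and \<open>\<zeta> l ^ b\<close>
        have modulus \<open>1\<close> and drop out.\<close>
      have "(\<Sum>j<m. (cmod (B $$ (j, l)))\<^sup>2)
          = (\<Sum>j<m. (cmod (\<eta> l ^ (j div q) - \<eta> l ^ (p - 1)))\<^sup>2 / (real (p * q))\<^sup>2)"
        by (intro sum.cong)
           (auto simp: B_def C_def l norm_mult norm_power norm_divide \<epsilon>\<epsilon> norm_\<zeta> power_divide
                 simp flip: complex_cnj_power complex_cnj_diff complex_cnj_mult)
      also have "\<dots> = (\<Sum>a<p - 1. \<Sum>b<q. (cmod (\<eta> l ^ a - \<eta> l ^ (p - 1)))\<^sup>2 / (real (p * q))\<^sup>2)"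
        unfolding m by (rule sum_div_mod[OF q])
      also have "\<dots> = real q * (\<Sum>a<p - 1. (cmod (\<eta> l ^ a - \<eta> l ^ (p - 1)))\<^sup>2) / (real (p * q))\<^sup>2"
        by (simp add: sum_distrib_left sum_divide_distrib)
      also have "\<dots> = real q * (2 * real p) / (real (p * q))\<^sup>2"
        using sum_cmod_diff_powers[of "\<eta> l" p] root nontriv l p by (simp add: \<eta>_def)
      also have "\<dots> = 2 / real (p * q)"
        using p q by (simp add: power2_eq_square)
      finally show "(\<Sum>j<m. (cmod (B $$ (j, l)))\<^sup>2) = 2 / real (p * q)" .
    qed
    also have "\<dots> = 2 * (1 - 1 / real p)"
      using p q by (simp add: m of_nat_diff field_simps)
    finally show ?thesis .
  qed
  have "mat_cond (vandermonde_mat m \<zeta>) = frobenius_norm (vandermonde_mat m \<zeta>) * frobenius_norm B"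
    by (rule mat_cond_eqI[OF _ _ AB]) (auto simp: vandermonde_mat_def B_def)
  moreover have "frobenius_norm B = sqrt (2 * (1 - 1 / real p))"
    using norm_B by (simp add: frobenius_norm_def B_def)
  ultimately show ?thesis
    by (simp add: frobenius_norm_vandermonde_mat norm_\<zeta>)
qed

theorem theorem1p2:
  fixes n p :: nat and \<zeta> :: "nat \<Rightarrow> complex"
  assumes "n > 0"
    and "prime p"
    and "(\<exists>k>0. n = p ^ k) \<or> (odd p \<and> (\<exists>k>0. \<exists>l>0. n = 2 ^ k * p ^ l))"
    and "bij_betw \<zeta> {..<totient n} (primitive_roots_of_unity n)"
  shows "mat_cond (vandermonde_mat (totient n) \<zeta>)
           = real (totient n) * sqrt (2 * (1 - 1 / real p))"
proof -
  have p: "p > 1" using assms(2) by (rule prime_gt_1_nat)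
  have inj: "inj_on \<zeta> {..<totient n}"
    using assms(4) by (rule bij_betw_imp_inj_on)
  have "\<zeta> i \<in> primitive_roots_of_unity n" if "i < totient n" for i
    using assms(4) that by (auto dest: bij_betwE)
  then have root: "\<zeta> i ^ n = 1" and prim: "\<And>k. 0 < k \<Longrightarrow> k < n \<Longrightarrow> \<zeta> i ^ k \<noteq> 1"
    if "i < totient n" for i
    using that by (auto simp: primitive_roots_of_unity_def)
  from assms(3) show ?thesis
  proof (elim disjE exE conjE)
    fix k :: nat assume k: "k > 0" "n = p ^ k"
    define q where "q = p ^ (k - 1)"
    \<comment> \<open>The bound \<open>q < n\<close> lets primitivity exclude
      \<open>\<zeta> i ^ q = 1\<close>.\<close>
    have q: "q > 0" "n = q * p" "q < n"
      using k p by (auto simp: q_def power_Suc2[symmetric] simp del: power_Suc)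
    have "totient n = (p - 1) * q"
      using k assms(2) by (simp add: totient_prime_power q_def)
    then show ?thesis
      using q root prim
      by (intro mat_cond_vandermonde_mat[where \<epsilon> = 1] p inj)
         (auto simp flip: power_mult)
  next
    fix k l :: nat assume kl: "odd p" "k > 0" "l > 0" "n = 2 ^ k * p ^ l"
    define q where "q = 2 ^ (k - 1) * p ^ (l - 1)"
    have q: "q > 0" "n = 2 * (q * p)"
      using kl p by (cases k; cases l; simp add: q_def)+
    have p2: "p > 2" using p kl(1) by (cases "p = 2") auto
    have "coprime (2 ^ k) (p ^ l)"
      using kl(1) by simp
    then have "totient n = totient (2 ^ k) * totient (p ^ l)"
      by (simp add: kl(4) totient_mult_coprime)
    then have tot: "totient n = (p - 1) * q"
      using kl assms(2) by (simp add: totient_prime_power q_def)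
    have "(- (\<zeta> i ^ q)) ^ p = 1" "- (\<zeta> i ^ q) \<noteq> 1" if i: "i < totient n" for i
    proof -
      \<comment> \<open>Half the exponent \<open>n\<close> gives a square root of \<open>1\<close>
        other than \<open>1\<close>, hence \<open>-1\<close>; for odd \<open>p\<close> the sign
        passes through the \<open>p\<close>-th power.\<close>
      have "(\<zeta> i ^ (q * p))\<^sup>2 = 1"
        using root[OF i] q by (simp add: power_mult[symmetric] mult.commute)
      moreover have "\<zeta> i ^ (q * p) \<noteq> 1"
        using prim[OF i, of "q * p"] q p by simp
      ultimately have "\<zeta> i ^ (q * p) = -1"
        by (simp add: power2_eq_1_iff)
      then show "(- (\<zeta> i ^ q)) ^ p = 1"
        using kl(1) by (simp add: power_mult)
      \<comment> \<open>Squaring \<open>- (\<zeta> i ^ q) = 1\<close> would contradict this.\<close>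
      have "\<zeta> i ^ (q * 2) \<noteq> 1"
        using prim[OF i, of "q * 2"] q p2 by simp
      then show "- (\<zeta> i ^ q) \<noteq> 1"
        unfolding power_mult by (metis minus_equation_iff power2_minus one_power2)
    qed
    then show ?thesis
      using q tot by (intro mat_cond_vandermonde_mat[where \<epsilon> = "-1"] p inj) auto
  qed
qed

end
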